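(* Let $\sigma(x)=\frac{Ax+B}{Cx+D}$ with $A,B,C,D\in\mathbb{Z}$ and $|AD-BC|=2$, let $S=\begin{pmatrix}A&B\\C&D\end{pmatrix}$, and let $T$ be a unimodular integer matrix such that $S=TM$, $S=TMR$ or $S=TMRJ$. All products $\prod_{k=1}^{+\infty}$ below are ordered infinite matrix products (factors multiplied from left to right). 1) If $\alpha_0=[e_0,e_1,e_2,\ldots]$ is of type CF1, then $\sigma(\alpha_0)$ is equivalent to one of the following matrix products: $$T\prod_{k=1}^{+\infty}\left(RL^{\frac{e_{2k-2}-2}{2}}RLR^{\frac{e_{2k-1}-2}{2}}L\right),$$ $$TR\prod_{k=1}^{+\infty}\left(L^{\frac{e_{2k-2}}{2}}R^{2e_{2k-1}}\right),$$ $$TR^{2e_0+1}\prod_{k=1}^{+\infty}\left(L^{\frac{e_{2k-1}}{2}}R^{2e_{2k}}\right).$$ 2) If $\alpha_0=[d_0,d_1,d_2,\ldots]$ is of type CF2, then $\sigma(\alpha_0)$ is equivalent to one of the following matrix products: $$T\prod_{k=1}^{+\infty}\left(RL^{\frac{d_{6k-6}-1}{2}}R^{2d_{6k-5}}L^{\frac{d_{6k-4}-1}{2}}RLR^{\frac{d_{6k-3}-1}{2}}L^{2d_{6k-2}}R^{\frac{d_{6k-1}-1}{2}}L\right),$$ $$TRL^{\frac{d_0-1}{2}}R\prod_{k=1}^{+\infty}\left(LR^{\frac{d_{6k-5}-1}{2}}L^{2d_{6k-4}}R^{\frac{d_{6k-3}-1}{2}}LRL^{\frac{d_{6k-2}-1}{2}}R^{2d_{6k-1}}L^{\frac{d_{6k}-1}{2}}R\right),$$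 $$TR^{2d_0+1}L^{\frac{d_1-1}{2}}R\prod_{k=1}^{+\infty}\left(LR^{\frac{d_{6k-4}-1}{2}}L^{2d_{6k-3}}R^{\frac{d_{6k-2}-1}{2}}LRL^{\frac{d_{6k-1}-1}{2}}R^{2d_{6k}}L^{\frac{d_{6k+1}-1}{2}}R\right).$$ 3) If $\alpha_0=[d_0,e_1,d_2,e_3,\ldots]$ is of type CF3, then $\sigma(\alpha_0)$ is equivalent to one of the following matrix products: $$T\prod_{k=1}^{+\infty}\left(RL^{\frac{d_{4k-4}-1}{2}}R^{2e_{4k-3}}L^{\frac{d_{4k-2}-1}{2}}RLR^{\frac{e_{4k-1}-2}{2}}L\right),$$ $$TRL^{\frac{d_0-1}{2}}RLR^{\frac{e_1-2}{2}}L\prod_{k=1}^{+\infty}\left(RL^{\frac{d_{4k-2}-1}{2}}R^{2e_{4k-1}}L^{\frac{d_{4k}-1}{2}}RLR^{\frac{e_{4k+1}-2}{2}}L\right),$$ $$TR^{2d_0+1}\prod_{k=1}^{+\infty}\left(L^{\frac{e_{2k-1}}{2}}R^{2d_{2k}}\right).$$ 4) If $\alpha_0=[e_0,d_1,e_2,d_3,\ldots]$ is of type CF4, then $\sigma(\alpha_0)$ is equivalent to one of the following matrix products: $$TRL^{\frac{e_0-2}{2}}R\prod_{k=1}^{+\infty}\left(LR^{\frac{d_{4k-3}-1}{2}}L^{2e_{4k-2}}R^{\frac{d_{4k-1}-1}{2}}LRL^{\frac{e_{4k}-2}{2}}R\right),$$ $$TR\prod_{k=1}^{+\infty}\left(L^{\frac{e_{2k-2}}{2}}R^{2d_{2k-1}}\right),$$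 $$TR^{2e_0+1}L^{\frac{d_1-1}{2}}RLR^{\frac{e_2-2}{2}}L\prod_{k=1}^{+\infty}\left(RL^{\frac{d_{4k-1}-1}{2}}R^{2e_{4k}}L^{\frac{d_{4k+1}-1}{2}}RLR^{\frac{e_{4k+2}-2}{2}}L\right).$$
   Context: Notation: $M=\begin{pmatrix}1&1\\1&-1\end{pmatrix}$, $R=\begin{pmatrix}1&1\\0&1\end{pmatrix}$, $L=\begin{pmatrix}1&0\\1&1\end{pmatrix}$, $J=\begin{pmatrix}0&1\\1&0\end{pmatrix}$. Unimodular means determinant $\pm1$. A matrix $T$ as in the claim always exists when $|\det S|=2$. $[a_0,a_1,a_2,\ldots]$ denotes the infinite simple continued fraction $a_0+\cfrac{1}{a_1+\cfrac{1}{a_2+\cdots}}$. Types of continued fractions (all partial quotients, including the first, are positive integers; $e_i$ always denotes an even positive integer and $d_i$ an odd positive integer): CF1: $[e_0,e_1,e_2,\ldots]$, all partial quotients even. CF2: $[d_0,d_1,d_2,\ldots]$, all partial quotients odd. CF3: $[d_0,e_1,d_2,e_3,\ldots]$, odd at even indices and even at odd indices. CF4: $[e_0,d_1,e_2,d_3,\ldots]$, even at even indices and odd at odd indices. Equivalence with a matrix product (Raney's representation): the continued fraction $[a_0,a_1,a_2,a_3,\ldots]$ is equivalent to the infinite product $R^{a_0}L^{a_1}R^{a_2}L^{a_3}\cdots$. More generally, a real number $y$ is equivalent to an infinite product $X_0X_1X_2\cdots$ of $2\times2$ integer matrices if, for the partial products $X_0\cdots X_n=\begin{pmatrix}r_n&s_n\\t_n&w_n\end{pmatrix}$,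 both $r_n/t_n$ and $s_n/w_n$ tend to $y$ as $n\to\infty$ (finitely many undefined ratios being disregarded). Exponents equal to $0$ are allowed. *)

theory Defs
  imports "HOL-Analysis.Analysis" "HOL-Library.Stream"
begin

type_synonym int_mat = "int^2^2"

definition mat_M :: int_mat where "mat_M = vector [vector [1, 1], vector [1, -1]]"
definition mat_R :: int_mat where "mat_R = vector [vector [1, 1], vector [0, 1]]"
definition mat_L :: int_mat where "mat_L = vector [vector [1, 0], vector [1, 1]]"
definition mat_J :: int_mat where "mat_J = vector [vector [0, 1], vector [1, 0]]"

text \<open>The overloaded power on \<^typ>\<open>int^2^2\<close> is componentwise, hence a separate notation for
  the power with respect to matrix multiplication.\<close>

definition mat_power :: "int_mat \<Rightarrow> nat \<Rightarrow> int_mat"  (infixr "^\<^sub>m" 80) where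
  "X ^\<^sub>m n = (((**) X) ^^ n) (mat 1)"

definition unimodular :: "int_mat \<Rightarrow> bool" where
  "unimodular T \<longleftrightarrow> \<bar>det T\<bar> = 1"

text \<open>\<open>cf_convergent a n\<close> is the finite continued fraction $[a_0,\ldots,a_n]$, and \<open>cf a\<close> the value
  of the infinite one, i.e. the limit of its convergents.\<close>

fun cf_convergent :: "(nat \<Rightarrow> nat) \<Rightarrow> nat \<Rightarrow> real" where
  "cf_convergent a 0 = real (a 0)"
| "cf_convergent a (Suc n) = real (a 0) + 1 / cf_convergent (\<lambda>k. a (Suc k)) n"

definition cf :: "(nat \<Rightarrow> nat) \<Rightarrow> real" where
  "cf a = lim (cf_convergent a)"

definition CF1 :: "(nat \<Rightarrow> nat) \<Rightarrow> bool" where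
  "CF1 a \<longleftrightarrow> (\<forall>k. a k > 0 \<and> even (a k))"

definition CF2 :: "(nat \<Rightarrow> nat) \<Rightarrow> bool" where
  "CF2 a \<longleftrightarrow> (\<forall>k. a k > 0 \<and> odd (a k))"

definition CF3 :: "(nat \<Rightarrow> nat) \<Rightarrow> bool" where
  "CF3 a \<longleftrightarrow> (\<forall>k. a k > 0 \<and> (even k \<longrightarrow> odd (a k)) \<and> (odd k \<longrightarrow> even (a k)))"

definition CF4 :: "(nat \<Rightarrow> nat) \<Rightarrow> bool" where
  "CF4 a \<longleftrightarrow> (\<forall>k. a k > 0 \<and> (even k \<longrightarrow> even (a k)) \<and> (odd k \<longrightarrow> odd (a k)))"

text \<open>An infinite ordered product $X_0X_1X_2\cdots$ is represented by the stream of its factors.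
  For a product over $k\ge 1$ of blocks, every factor written inside a block (a matrix or a power
  of a matrix) is a factor of its own, so the partial products also stop inside the blocks.\<close>

definition block_product :: "(nat \<Rightarrow> int_mat list) \<Rightarrow> int_mat stream" where
  "block_product B = flat (smap B (fromN 1))"

definition partial_product :: "int_mat stream \<Rightarrow> nat \<Rightarrow> int_mat" where
  "partial_product X n = foldl (**) (mat 1) (stake (Suc n) X)"

text \<open>Only finitely many of the ratios may be undefined; the limits do not see these.\<close>

definition equiv_product :: "real \<Rightarrow> int_mat stream \<Rightarrow> bool" where
  "equiv_product y X \<longleftrightarrow>
     (\<forall>\<^sub>F n in sequentially. partial_product X n $ 2 $ 1 \<noteq> 0 \<and> partial_product X n $ 2 $ 2 \<noteq> 0) \<and>
     (\<lambda>n. of_int (partial_product X n $ 1 $ 1) / of_int (partial_product X n $ 2 $ 1)) \<longlonglongrightarrow> y \<and>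
     (\<lambda>n. of_int (partial_product X n $ 1 $ 2) / of_int (partial_product X n $ 2 $ 2)) \<longlonglongrightarrow> y"

end

theory Submission
  imports Defs
begin

text \<open>
  The proof runs Raney's transducer for determinant 2. Write \<open>\<alpha>\<^sub>k = [a\<^sub>k, a\<^sub>k\<^sub>+\<^sub>1, \<dots>]\<close>, so that
  \<open>\<alpha>\<^sub>k = a\<^sub>k + 1 / \<alpha>\<^sub>k\<^sub>+\<^sub>1\<close>. Up to inversion, only three functions of \<open>x\<close> ever occur while the partial
  quotients are read: \<open>(x + 1) / (x - 1)\<close> (the action of the matrix \<open>M\<close>), \<open>2 * x\<close> and \<open>x / 2\<close>; these are
  the states \<open>val_M\<close>, \<open>val_D\<close>, \<open>val_E\<close>. Reading \<open>a\<^sub>k\<close> in one of these states emits a short word in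
  \<open>R\<close> and \<open>L\<close>, leads to a new state and moves on to \<open>\<alpha>\<^sub>k\<^sub>+\<^sub>1\<close>; the shape of the word and the new state
  are determined by the old state and the parity of \<open>a\<^sub>k\<close> (the lemmas \<open>read_M_even\<close> to \<open>read_E_odd\<close>). An inverted state behaves in the
  same way with \<open>R\<close> and \<open>L\<close> exchanged. If the parities of the partial quotients are periodic, then so
  is the run of the transducer, and the words emitted during one period form the blocks of the
  products in the theorem. The three forms of \<open>S\<close> give the three initial states:
  \<open>M x\<close>, \<open>MR x = 1 + 2 / x\<close> and \<open>MRJ x = 1 + 2 * x\<close>, which explains why there are three products
  for each type of continued fraction.

  What remains is convergence, and it comes from one estimate. A product \<open>Q\<close> of powers of \<open>R\<close> and \<open>L\<close>
  is a nonnegative integer matrix of determinant 1; if \<open>z = Q y\<close> for some \<open>y > 0\<close> and both entries of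
  the second row of \<open>Q\<close> are at least \<open>N\<close>, then \<open>z\<close> and the ratios of the columns of every further
  partial product differ by at most \<open>1 / N\<close> (\<open>column_estimate\<close>), because all these numbers lie in the
  image under \<open>Q\<close> of the half line from 0 to infinity, a short interval. The second row grows
  with every block, as each block contains positive powers of both \<open>R\<close> and \<open>L\<close>
  (\<open>converges_to_block_product\<close>). The same growth shows that \<open>z\<close> is irrational, so that the denominator of \<open>T z\<close> does not vanish and the factor \<open>T\<close> can be put in front.
\<close>

section \<open>Integer matrices as fractional linear maps\<close>

definition mob :: "int_mat \<Rightarrow> real \<Rightarrow> real" where
  "mob X x = (of_int (X$1$1) * x + of_int (X$1$2)) / (of_int (X$2$1) * x + of_int (X$2$2))"

lemma matrix_mult_2_entries:
  fixes X Y :: "'a::semiring_1^2^2"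
  shows "(X ** Y)$i$j = X$i$1 * Y$1$j + X$i$2 * Y$2$j"
  by (simp add: matrix_matrix_mult_def sum_2)

lemma mat_1_entries [simp]:
  "(mat 1 :: int_mat)$1$1 = 1" "(mat 1 :: int_mat)$1$2 = 0"
  "(mat 1 :: int_mat)$2$1 = 0" "(mat 1 :: int_mat)$2$2 = 1"
  by (simp_all add: mat_def)

lemma mob_mult:
  assumes "of_int (Y$2$1) * x + of_int (Y$2$2) \<noteq> (0::real)"
  shows "mob (X ** Y) x = mob X (mob Y x)"
proof -
  define u where "u = of_int (Y$1$1) * x + of_int (Y$1$2)"
  define v where "v = of_int (Y$2$1) * x + of_int (Y$2$2)"
  have v: "v \<noteq> 0" using assms by (simp add: v_def)
  have "mob X (u / v) = (of_int (X$1$1) * u + of_int (X$1$2) * v) / (of_int (X$2$1) * u + of_int (X$2$2) * v)"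
  proof -
    have "mob X (u / v) = ((of_int (X$1$1) * u + of_int (X$1$2) * v) / v) / ((of_int (X$2$1) * u + of_int (X$2$2) * v) / v)"
      using v by (simp add: mob_def add_divide_distrib)
    then show ?thesis using v by simp
  qed
  moreover have "mob Y x = u / v" by (simp add: mob_def u_def v_def)
  moreover have "mob (X ** Y) x = (of_int (X$1$1) * u + of_int (X$1$2) * v) / (of_int (X$2$1) * u + of_int (X$2$2) * v)"
    by (simp add: mob_def u_def v_def matrix_mult_2_entries algebra_simps)
  ultimately show ?thesis by simp
qed

lemma mat_R_power: "mat_R ^\<^sub>m n = vector [vector [1, int n], vector [0, 1]]"
  by (induction n)
    (simp_all add: mat_power_def mat_R_def vec_eq_iff forall_2 matrix_mult_2_entries)

lemma mat_L_power: "mat_L ^\<^sub>m n = vector [vector [1, 0], vector [int n, 1]]"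
  by (induction n)
    (simp_all add: mat_power_def mat_L_def vec_eq_iff forall_2 matrix_mult_2_entries)

lemma letter_entries [simp]:
  "mat_R$1$1 = 1" "mat_R$1$2 = 1" "mat_R$2$1 = 0" "mat_R$2$2 = 1"
  "mat_L$1$1 = 1" "mat_L$1$2 = 0" "mat_L$2$1 = 1" "mat_L$2$2 = 1"
  by (simp_all add: mat_R_def mat_L_def)

lemma letter_power_entries [simp]:
  "(mat_R ^\<^sub>m n)$1$1 = 1" "(mat_R ^\<^sub>m n)$1$2 = int n"
  "(mat_R ^\<^sub>m n)$2$1 = 0" "(mat_R ^\<^sub>m n)$2$2 = 1"
  "(mat_L ^\<^sub>m n)$1$1 = 1" "(mat_L ^\<^sub>m n)$1$2 = 0"
  "(mat_L ^\<^sub>m n)$2$1 = int n" "(mat_L ^\<^sub>m n)$2$2 = 1"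
  by (simp_all add: mat_R_power mat_L_power)

lemma mob_letters:
  "mob mat_R x = x + 1" "mob (mat_R ^\<^sub>m n) x = x + real n"
  "mob mat_L x = x / (x + 1)" "mob (mat_L ^\<^sub>m n) x = x / (real n * x + 1)"
  by (simp_all add: mob_def)

section \<open>Nonnegative integer matrices of determinant 1\<close>

definition nonneg_SL2 :: "int_mat \<Rightarrow> bool" where
  "nonneg_SL2 X \<longleftrightarrow> det X = 1 \<and> (\<forall>i j. 0 \<le> X$i$j)"

lemma nonneg_SL2_nonneg: "nonneg_SL2 X \<Longrightarrow> 0 \<le> X$i$j"
  by (simp add: nonneg_SL2_def)

lemma nonneg_SL2_diagonal:
  assumes "nonneg_SL2 X"
  shows "1 \<le> X$1$1" "1 \<le> X$2$2"
proof -
  have nn: "0 \<le> X$1$1" "0 \<le> X$2$2" "0 \<le> X$1$2 * X$2$1"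
    using assms by (simp_all add: nonneg_SL2_def)
  have "X$1$1 * X$2$2 = 1 + X$1$2 * X$2$1"
    using assms by (simp add: nonneg_SL2_def det_2)
  with nn have "X$1$1 * X$2$2 \<noteq> 0" by linarith
  with nn show "1 \<le> X$1$1" "1 \<le> X$2$2" by (simp_all add: int_one_le_iff_zero_less order.strict_iff_order)
qed

lemma nonneg_SL2_letters [simp]:
  "nonneg_SL2 mat_R" "nonneg_SL2 (mat_R ^\<^sub>m n)" "nonneg_SL2 mat_L" "nonneg_SL2 (mat_L ^\<^sub>m n)"
  "nonneg_SL2 (mat 1)"
  by (simp_all add: nonneg_SL2_def det_2 forall_2)

lemma nonneg_SL2_mult [intro]: "nonneg_SL2 X \<Longrightarrow> nonneg_SL2 Y \<Longrightarrow> nonneg_SL2 (X ** Y)"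
  by (simp add: nonneg_SL2_def det_mul matrix_mult_2_entries)

lemma mob_denominator_pos:
  fixes x :: real
  assumes "nonneg_SL2 X" "0 < x"
  shows "0 < of_int (X$2$1) * x + of_int (X$2$2)"
proof -
  have "0 \<le> real_of_int (X$2$1) * x" using assms by (simp add: nonneg_SL2_nonneg)
  moreover have "1 \<le> real_of_int (X$2$2)" using assms nonneg_SL2_diagonal by simp
  ultimately show ?thesis by linarith
qed

definition mat_prod :: "int_mat list \<Rightarrow> int_mat" where
  "mat_prod Xs = foldr (**) Xs (mat 1)"

lemma mat_prod_simps [simp]:
  "mat_prod [] = mat 1" "mat_prod (X # Xs) = X ** mat_prod Xs"
  by (simp_all add: mat_prod_def)

lemma mat_prod_append: "mat_prod (Xs @ Ys) = mat_prod Xs ** mat_prod Ys"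
  by (induction Xs) (simp_all add: matrix_mul_assoc)

lemma partial_product_eq_mat_prod: "partial_product X n = mat_prod (stake (Suc n) X)"
proof -
  have "foldl (**) A Xs = A ** mat_prod Xs" for A :: int_mat and Xs
    by (induction Xs arbitrary: A) (simp_all add: matrix_mul_assoc)
  then show ?thesis by (simp add: partial_product_def del: stake.simps)
qed

lemma nonneg_SL2_mat_prod: "\<forall>X\<in>set Xs. nonneg_SL2 X \<Longrightarrow> nonneg_SL2 (mat_prod Xs)"
  by (induction Xs) auto

lemma mob_mat_prod:
  assumes "\<forall>X\<in>set Xs. nonneg_SL2 X" "0 < x"
  shows "mob (mat_prod Xs) x = foldr mob Xs x"
  using assms
proof (induction Xs)
  case Nil
  then show ?case by (simp add: mob_def)
next
  case (Cons X Xs)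
  have "of_int (mat_prod Xs$2$1) * x + of_int (mat_prod Xs$2$2) > 0"
    using Cons.prems by (intro mob_denominator_pos nonneg_SL2_mat_prod) auto
  then show ?case using Cons by (simp add: mob_mult)
qed

lemma nonneg_SL2_mult_off_diagonal_pos:
  assumes "nonneg_SL2 X" "nonneg_SL2 Y"
  shows "0 < X$1$2 \<or> 0 < Y$1$2 \<Longrightarrow> 0 < (X ** Y)$1$2"
    and "0 < X$2$1 \<or> 0 < Y$2$1 \<Longrightarrow> 0 < (X ** Y)$2$1"
proof -
  have pos: "0 < X$1$1" "0 < X$2$2" "0 < Y$1$1" "0 < Y$2$2"
    using nonneg_SL2_diagonal[OF assms(1)] nonneg_SL2_diagonal[OF assms(2)] by simp_all
  have nn: "0 \<le> X$1$2" "0 \<le> X$2$1" "0 \<le> Y$1$2" "0 \<le> Y$2$1"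
    using assms by (simp_all add: nonneg_SL2_nonneg)
  show "0 < (X ** Y)$1$2" if "0 < X$1$2 \<or> 0 < Y$1$2"
    unfolding matrix_mult_2_entries using that pos nn
    by (metis add_nonneg_pos add_pos_nonneg mult_nonneg_nonneg mult_pos_pos less_imp_le)
  show "0 < (X ** Y)$2$1" if "0 < X$2$1 \<or> 0 < Y$2$1"
    unfolding matrix_mult_2_entries using that pos nn
    by (metis add_nonneg_pos add_pos_nonneg mult_nonneg_nonneg mult_pos_pos less_imp_le)
qed

lemma mat_prod_off_diagonal_pos:
  assumes "\<forall>X\<in>set Xs. nonneg_SL2 X"
  shows "\<exists>X\<in>set Xs. 0 < X$1$2 \<Longrightarrow> 0 < mat_prod Xs$1$2"
    and "\<exists>X\<in>set Xs. 0 < X$2$1 \<Longrightarrow> 0 < mat_prod Xs$2$1"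
  using assms
  by (induction Xs)
    (auto intro!: nonneg_SL2_mult_off_diagonal_pos nonneg_SL2_mat_prod)

text \<open>
  Both numbers compared are values of the fractional linear map \<open>Q\<close>, at \<open>p / q\<close> (possibly infinite)
  and at \<open>y\<close>. As the determinant of \<open>Q\<close> is 1, their difference is \<open>p - q * y\<close> divided by the product
  \<open>c * d\<close> of the two denominators. These are at least \<open>N * (p + q)\<close> and \<open>N * (y + 1)\<close>, while
  \<open>\<bar>p - q * y\<bar>\<close> is at most \<open>(p + q) * (y + 1)\<close>. The pair \<open>p\<close>, \<open>q\<close> will be a column of a later factor.
\<close>

lemma column_estimate:
  assumes Q: "nonneg_SL2 Q" and y: "0 < y" and N: "0 < N" "N \<le> Q$2$1" "N \<le> Q$2$2"
    and pq: "0 \<le> p" "0 \<le> q" "0 < p + q"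
  shows "0 < Q$2$1 * p + Q$2$2 * q"
    and "\<bar>of_int (Q$1$1 * p + Q$1$2 * q) / of_int (Q$2$1 * p + Q$2$2 * q) - mob Q y\<bar> \<le> 1 / of_int N"
proof -
  define c d where "c = (of_int (Q$2$1 * p + Q$2$2 * q) :: real)"
    and "d = of_int (Q$2$1) * y + of_int (Q$2$2)"
  have "N * (p + q) \<le> Q$2$1 * p + Q$2$2 * q"
    using N pq by (simp add: distrib_left add_mono mult_right_mono)
  moreover have Npq: "0 < N * (p + q)" using N pq by simp
  ultimately show "0 < Q$2$1 * p + Q$2$2 * q" by linarith
  have pq': "1 \<le> real_of_int (p + q)" using pq by linarith
  have c: "real_of_int N * of_int (p + q) \<le> c"
    using \<open>N * (p + q) \<le> _\<close> unfolding c_def by (metis of_int_le_iff of_int_mult)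
  have d: "real_of_int N * (y + 1) \<le> d"
    unfolding d_def using N y by (simp add: distrib_left add_mono mult_right_mono)
  have c0: "0 < c" using c Npq by (smt (verit) of_int_0_less_iff of_int_mult)
  have d0: "0 < d" using d N y by (smt (verit) mult_pos_pos of_int_0_less_iff)
  have det: "real_of_int (Q$1$1) * of_int (Q$2$2) - of_int (Q$1$2) * of_int (Q$2$1) = 1"
  proof -
    have "Q$1$1 * Q$2$2 - Q$1$2 * Q$2$1 = 1" using Q by (simp add: nonneg_SL2_def det_2)
    from arg_cong[OF this, of real_of_int] show ?thesis by simp
  qed
  have "of_int (Q$1$1 * p + Q$1$2 * q) / c - mob Q y
      = (of_int (Q$1$1 * p + Q$1$2 * q) * d - (of_int (Q$1$1) * y + of_int (Q$1$2)) * c) / (c * d)"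
    using c0 d0 by (simp add: mob_def d_def[symmetric] diff_frac_eq)
  also have "of_int (Q$1$1 * p + Q$1$2 * q) * d - (of_int (Q$1$1) * y + of_int (Q$1$2)) * c
      = (real_of_int (Q$1$1) * of_int (Q$2$2) - of_int (Q$1$2) * of_int (Q$2$1)) * (of_int p - of_int q * y)"
    unfolding c_def d_def by (simp add: algebra_simps)
  finally have diff: "of_int (Q$1$1 * p + Q$1$2 * q) / c - mob Q y = (of_int p - of_int q * y) / (c * d)"
    by (simp add: det)
  have N1: "1 \<le> real_of_int N" using N by simp
  have "real_of_int N * \<bar>of_int p - of_int q * y\<bar> \<le> real_of_int N * (of_int (p + q) * (y + 1))"
  proof -
    have "0 \<le> real_of_int q * y" "0 \<le> real_of_int p * y" using pq y by simp_all
    moreover have "0 \<le> real_of_int p" "0 \<le> real_of_int q" using pq by simp_all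
    ultimately have "\<bar>of_int p - of_int q * y\<bar> \<le> of_int (p + q) * (y + 1)"
      by (simp add: algebra_simps)
    then show ?thesis using N by simp
  qed
  also have "\<dots> = (real_of_int N * of_int (p + q)) * (y + 1)" by simp
  also have "\<dots> \<le> c * d"
  proof (rule mult_mono)
    show "y + 1 \<le> d" using d N1 y by (smt (verit) mult_le_cancel_right1)
  qed (use c c0 y in auto)
  finally show "\<bar>of_int (Q$1$1 * p + Q$1$2 * q) / of_int (Q$2$1 * p + Q$2$2 * q) - mob Q y\<bar> \<le> 1 / of_int N"
    unfolding c_def[symmetric] diff using c0 d0 N by (simp add: abs_mult field_simps)
qed

text \<open>
  If \<open>c * z + d = 0\<close> for \<open>z = Q y\<close>, then the integer row \<open>(g, h) = (c, d) Q\<close> satisfies \<open>g * y + h = 0\<close>,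
  so \<open>g\<close> and \<open>h\<close> have opposite signs. Solving for \<open>c\<close> with the inverse of \<open>Q\<close> makes \<open>\<bar>c\<bar>\<close> at least as
  large as an entry of the second row of \<open>Q\<close>.
\<close>

lemma integer_relation_excluded:
  assumes Q: "nonneg_SL2 Q" and y: "0 < y" and N: "\<bar>c\<bar> < Q$2$1" "\<bar>c\<bar> < Q$2$2"
    and cd: "c \<noteq> 0 \<or> d \<noteq> 0"
  shows "of_int c * mob Q y + of_int d \<noteq> 0"
proof
  assume eq: "of_int c * mob Q y + of_int d = 0"
  define g h where "g = c * Q$1$1 + d * Q$2$1" and "h = c * Q$1$2 + d * Q$2$2"
  have "0 < of_int (Q$2$1) * y + of_int (Q$2$2)" using mob_denominator_pos Q y by blast
  with eq have "of_int c * (of_int (Q$1$1) * y + of_int (Q$1$2)) + of_int d * (of_int (Q$2$1) * y + of_int (Q$2$2)) = 0"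
    by (simp add: mob_def field_simps)
  then have "of_int g * y = - real_of_int h" by (simp add: g_def h_def algebra_simps)
  then have sign: "g = 0 \<and> h = 0 \<or> 0 < g \<and> h < 0 \<or> g < 0 \<and> 0 < h"
    using y by (smt (verit) mult_pos_pos mult_neg_pos of_int_0_less_iff of_int_less_0_iff of_int_0_eq_iff mult_eq_0_iff)
  have det: "Q$1$1 * Q$2$2 - Q$1$2 * Q$2$1 = 1" using Q by (simp add: nonneg_SL2_def det_2)
  have "c * (Q$1$1 * Q$2$2 - Q$1$2 * Q$2$1) = g * Q$2$2 - h * Q$2$1"
    "d * (Q$1$1 * Q$2$2 - Q$1$2 * Q$2$1) = h * Q$1$1 - g * Q$1$2"
    by (simp_all add: g_def h_def algebra_simps)
  then have c: "c = g * Q$2$2 - h * Q$2$1" and d: "d = h * Q$1$1 - g * Q$1$2"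
    by (simp_all add: det)
  from sign cd c d consider "0 < g" "h < 0" | "g < 0" "0 < h" by auto
  then show False
  proof cases
    case 1
    then have "Q$2$2 \<le> g * Q$2$2" "h * Q$2$1 \<le> 0"
      using N by (auto simp: mult_le_cancel_right1 mult_le_0_iff)
    with c N show False by linarith
  next
    case 2
    then have "g * Q$2$2 \<le> 0" "Q$2$1 \<le> h * Q$2$1"
      using N by (auto simp: mult_le_cancel_right1 mult_le_0_iff)
    with c N show False by linarith
  qed
qed

section \<open>Convergence of infinite products\<close>

text \<open>
  The point \<open>z\<close> lies in the images of the positive half line under partial products with arbitrarily
  large second rows. Only some of the prefixes need to be known, which makes it possible to look
  at the ends of the blocks alone.
\<close>

definition converges_to :: "int_mat stream \<Rightarrow> real \<Rightarrow> bool" where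
  "converges_to s z \<longleftrightarrow> (\<forall>X\<in>sset s. nonneg_SL2 X) \<and>
    (\<forall>N. \<exists>Xs s' y. s = Xs @- s' \<and> 0 < y \<and> foldr mob Xs y = z \<and>
       N \<le> mat_prod Xs$2$1 \<and> N \<le> mat_prod Xs$2$2)"

lemma converges_to_prefix:
  assumes "converges_to s z"
  obtains Xs s' y where "s = Xs @- s'" "0 < y" "mob (mat_prod Xs) y = z" "nonneg_SL2 (mat_prod Xs)"
    "N \<le> mat_prod Xs$2$1" "N \<le> mat_prod Xs$2$2"
proof -
  obtain Xs s' y where *: "s = Xs @- s'" "0 < y" "foldr mob Xs y = z"
      "N \<le> mat_prod Xs$2$1" "N \<le> mat_prod Xs$2$2"
    using assms unfolding converges_to_def by meson
  moreover from * assms have "\<forall>X\<in>set Xs. nonneg_SL2 X" by (auto simp: converges_to_def)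
  ultimately show thesis using that by (metis mob_mat_prod nonneg_SL2_mat_prod)
qed

lemma converges_to_irrational:
  assumes "converges_to s z" "c \<noteq> 0 \<or> d \<noteq> 0"
  shows "of_int c * z + of_int d \<noteq> 0"
  using converges_to_prefix[OF assms(1), of "\<bar>c\<bar> + 1"] integer_relation_excluded assms(2)
  by (metis add1_zle_eq)

text \<open>
  Every later partial product is \<open>mat_prod Xs ** Y\<close>, where \<open>Y\<close> is again nonnegative of determinant 1; its
  column \<open>j\<close> is the image of column \<open>j\<close> of \<open>Y\<close>. This covers the partial products that stop inside
  a block.
\<close>

lemma converges_to_estimate:
  assumes "converges_to s z" "0 < N"
  shows "\<forall>\<^sub>F n in sequentially. \<forall>j. 0 < partial_product s n$2$j \<and>
    \<bar>of_int (partial_product s n$1$j) / of_int (partial_product s n$2$j) - z\<bar> \<le> 1 / of_int N"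
proof -
  obtain Xs s' y where *: "s = Xs @- s'" "0 < y" "mob (mat_prod Xs) y = z" "nonneg_SL2 (mat_prod Xs)"
    "N \<le> mat_prod Xs$2$1" "N \<le> mat_prod Xs$2$2"
    using converges_to_prefix[OF assms(1)] .
  have "0 < partial_product s n$2$j \<and>
    \<bar>of_int (partial_product s n$1$j) / of_int (partial_product s n$2$j) - z\<bar> \<le> 1 / of_int N"
    if "length Xs \<le> n" for n j
  proof -
    define Y where "Y = mat_prod (stake (Suc n - length Xs) s')"
    have "stake (Suc n) s = Xs @ stake (Suc n - length Xs) s'"
      using that by (simp add: * stake_shift del: stake.simps)
    then have part: "partial_product s n = mat_prod Xs ** Y"
      by (simp add: partial_product_eq_mat_prod Y_def mat_prod_append del: stake.simps)
    have "set (stake (Suc n - length Xs) s') \<subseteq> sset s"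
      by (auto simp: * in_set_conv_nth)
    then have Y: "nonneg_SL2 Y"
      using assms(1) unfolding Y_def by (intro nonneg_SL2_mat_prod) (auto simp: converges_to_def)
    then have "0 \<le> Y$1$j" "0 \<le> Y$2$j" "0 < Y$1$j + Y$2$j"
      using nonneg_SL2_diagonal[OF Y] exhaust_2[of j] nonneg_SL2_nonneg[OF Y]
      by (auto intro: add_pos_nonneg add_nonneg_pos simp: add_pos_nonneg add_nonneg_pos)
    from column_estimate[OF *(4,2) \<open>0 < N\<close> *(5,6) this] show ?thesis
      by (simp add: part matrix_mult_2_entries *(3))
  qed
  then show ?thesis unfolding eventually_sequentially by blast
qed

lemma converges_to_column:
  assumes "converges_to s z"
  shows "\<forall>\<^sub>F n in sequentially. partial_product s n$2$j \<noteq> 0"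
    and "(\<lambda>n. of_int (partial_product s n$1$j) / of_int (partial_product s n$2$j)) \<longlonglongrightarrow> z"
proof -
  show "\<forall>\<^sub>F n in sequentially. partial_product s n$2$j \<noteq> 0"
    using converges_to_estimate[OF assms zero_less_one]
    by eventually_elim (metis less_irrefl)
  show "(\<lambda>n. of_int (partial_product s n$1$j) / of_int (partial_product s n$2$j)) \<longlonglongrightarrow> z"
  proof (rule tendstoI)
    fix e :: real assume "0 < e"
    then obtain N :: nat where N: "inverse (real (Suc N)) < e" using reals_Archimedean by blast
    have "\<forall>\<^sub>F n in sequentially. \<forall>j. 0 < partial_product s n$2$j \<and>
      \<bar>of_int (partial_product s n$1$j) / of_int (partial_product s n$2$j) - z\<bar> \<le> 1 / of_int (int (Suc N))"
      by (rule converges_to_estimate[OF assms]) simp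
    then show "\<forall>\<^sub>F n in sequentially. dist (of_int (partial_product s n$1$j) / of_int (partial_product s n$2$j)) z < e"
    proof eventually_elim
      case (elim n)
      then have "dist (of_int (partial_product s n$1$j) / of_int (partial_product s n$2$j)) z \<le> inverse (real (Suc N))"
        by (simp add: dist_real_def inverse_eq_divide)
      also note N
      finally show ?case .
    qed
  qed
qed

text \<open>
  A unimodular matrix acts continuously at every point where its denominator is nonzero. The
  irrationality of \<open>z\<close> guarantees this at \<open>z\<close>.
\<close>

lemma equiv_product_mob:
  assumes "unimodular T" "converges_to s z"
  shows "equiv_product (mob T z) (T ## s)"
proof -
  have "T$2$1 \<noteq> 0 \<or> T$2$2 \<noteq> 0" using assms(1) by (auto simp: unimodular_def det_2)
  then have nz: "of_int (T$2$1) * z + of_int (T$2$2) \<noteq> 0"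
    using converges_to_irrational[OF assms(2)] by blast
  have part: "partial_product (T ## s) (Suc n) = T ** partial_product s n" for n
    by (simp add: partial_product_eq_mat_prod)
  have col: "(\<forall>\<^sub>F n in sequentially. partial_product (T ## s) n$2$j \<noteq> 0) \<and>
    (\<lambda>n. of_int (partial_product (T ## s) n$1$j) / of_int (partial_product (T ## s) n$2$j)) \<longlonglongrightarrow> mob T z" for j
  proof -
    define r t where "r n = real_of_int (partial_product s n$1$j)"
      and "t n = real_of_int (partial_product s n$2$j)" for n
    have t: "\<forall>\<^sub>F n in sequentially. t n \<noteq> 0"
      using converges_to_column(1)[OF assms(2), of j] by (simp add: t_def)
    have lim: "(\<lambda>n. r n / t n) \<longlonglongrightarrow> z"
      using converges_to_column(2)[OF assms(2), of j] by (simp add: r_def t_def)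
    have entry: "real_of_int (partial_product (T ## s) (Suc n)$i$j) = of_int (T$i$1) * r n + of_int (T$i$2) * t n" for i n
      by (simp add: part matrix_mult_2_entries r_def t_def)
    have den: "(\<lambda>n. of_int (T$i$1) * (r n / t n) + of_int (T$i$2)) \<longlonglongrightarrow> of_int (T$i$1) * z + of_int (T$i$2)" for i
      by (intro tendsto_intros lim)
    have "\<forall>\<^sub>F n in sequentially. of_int (T$2$1) * (r n / t n) + of_int (T$2$2) \<noteq> 0"
      using tendsto_imp_eventually_ne[OF den nz] .
    with t have "\<forall>\<^sub>F n in sequentially. of_int (T$2$1) * r n + of_int (T$2$2) * t n \<noteq> 0"
      by eventually_elim (simp add: field_simps)
    then have "\<forall>\<^sub>F n in sequentially. partial_product (T ## s) (Suc n)$2$j \<noteq> 0"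
      by eventually_elim (metis entry of_int_0)
    then have nonzero: "\<forall>\<^sub>F n in sequentially. partial_product (T ## s) n$2$j \<noteq> 0"
      by (simp only: eventually_sequentially_Suc[of "\<lambda>n. partial_product (T ## s) n$2$j \<noteq> 0"])
    have "(\<lambda>n. mob T (r n / t n)) \<longlonglongrightarrow> mob T z"
      unfolding mob_def by (intro tendsto_divide den nz)
    moreover have "\<forall>\<^sub>F n in sequentially. mob T (r n / t n)
        = of_int (partial_product (T ## s) (Suc n)$1$j) / of_int (partial_product (T ## s) (Suc n)$2$j)"
      using t
    proof eventually_elim
      case (elim n)
      have "mob T (r n / t n) = ((of_int (T$1$1) * r n + of_int (T$1$2) * t n) / t n)
          / ((of_int (T$2$1) * r n + of_int (T$2$2) * t n) / t n)"
        using elim by (simp add: mob_def add_divide_distrib)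
      then show ?case using elim by (simp add: entry)
    qed
    ultimately have "(\<lambda>n. of_int (partial_product (T ## s) (Suc n)$1$j) / of_int (partial_product (T ## s) (Suc n)$2$j)) \<longlonglongrightarrow> mob T z"
      by (rule Lim_transform_eventually)
    then show ?thesis using nonzero by (simp only: filterlim_sequentially_Suc[of "\<lambda>n. of_int (partial_product (T ## s) n$1$j) / of_int (partial_product (T ## s) n$2$j)"] simp_thms)
  qed
  from col[of 1] col[of 2] show ?thesis
    unfolding equiv_product_def by (simp add: eventually_conj)
qed

text \<open>
  Here \<open>\<zeta> k\<close> is the number that remains to be expanded after \<open>k\<close> blocks, and \<open>Ps\<close> are the factors
  before the first block. The product of a block has nonzero off-diagonal entries, hence all its entries are
  at least 1, and multiplying by it replaces both entries of a row by at least their sum.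
\<close>

lemma converges_to_block_product:
  fixes \<zeta> :: "nat \<Rightarrow> real"
  assumes Ps: "\<forall>X\<in>set Ps. nonneg_SL2 X"
    and B: "\<And>k. \<forall>X\<in>set (B (Suc k)). nonneg_SL2 X"
      "\<And>k. \<exists>X\<in>set (B (Suc k)). 0 < X$1$2" "\<And>k. \<exists>X\<in>set (B (Suc k)). 0 < X$2$1"
    and pos: "\<And>k. 0 < \<zeta> k" and step: "\<And>k. foldr mob (B (Suc k)) (\<zeta> (Suc k)) = \<zeta> k"
    and start: "foldr mob Ps (\<zeta> 0) = z"
  shows "converges_to (Ps @- block_product B) z"
proof -
  define W where "W k = concat (map B [1..<Suc k])" for k
  have W_Suc: "W (Suc k) = W k @ B (Suc k)" for k by (simp add: W_def)
  have W_nonneg: "\<forall>X\<in>set (W k). nonneg_SL2 X" for k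
    by (induction k) (use B in \<open>auto simp: W_Suc W_def[of 0]\<close>)
  have ne: "B (Suc k) \<noteq> []" for k using B(2)[of k] by auto
  have split: "block_product B = W k @- flat (smap B (fromN (Suc k)))" for k
  proof (induction k)
    case (Suc k)
    have "smap B (fromN (Suc k)) = B (Suc k) ## smap B (fromN (Suc (Suc k)))"
      by (subst siterate.code) simp
    then show ?case using Suc ne[of k] by (simp add: W_Suc flat_Stream)
  qed (simp add: block_product_def W_def)
  have "nonneg_SL2 X" if "X \<in> sset (Ps @- block_product B)" for X
  proof -
    have "sset (block_product B) = (\<Union>k\<in>{1..}. set (B k))"
    proof -
      have "\<forall>xs\<in>sset (smap B (fromN 1)). xs \<noteq> []"
      proof
        fix xs assume "xs \<in> sset (smap B (fromN 1))"
        then obtain k where "1 \<le> k" "xs = B k" by (auto simp: stream.set_map)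
        then show "xs \<noteq> []" using ne[of "k - 1"] by simp
      qed
      then show ?thesis unfolding block_product_def by (subst sset_flat) (auto simp: stream.set_map)
    qed
    moreover have "\<forall>X\<in>set (B k). nonneg_SL2 X" if "1 \<le> k" for k
      using B(1)[of "k - 1"] that by simp
    ultimately show ?thesis using that Ps by auto
  qed
  moreover have "\<exists>Xs s' y. Ps @- block_product B = Xs @- s' \<and> 0 < y \<and> foldr mob Xs y = z \<and>
       N \<le> mat_prod Xs$2$1 \<and> N \<le> mat_prod Xs$2$2" for N
  proof -
    have act: "foldr mob (W k) (\<zeta> k) = \<zeta> 0" for k
      by (induction k) (simp_all add: W_def[of 0] W_Suc step)
    \<comment> \<open>The maximum with 1 starts the growth: initially the row may be (0, 1).\<close>
    have grow: "int k \<le> mat_prod (Ps @ W k)$2$1 \<and> max 1 (int k) \<le> mat_prod (Ps @ W k)$2$2" for k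
    proof (induction k)
      case 0
      have "nonneg_SL2 (mat_prod Ps)" using Ps nonneg_SL2_mat_prod by blast
      then show ?case using nonneg_SL2_diagonal(2) nonneg_SL2_nonneg by (simp add: W_def)
    next
      case (Suc k)
      define Q P where "Q = mat_prod (Ps @ W k)" and "P = mat_prod (B (Suc k))"
      have P: "1 \<le> P$1$1" "1 \<le> P$2$2" "1 \<le> P$1$2" "1 \<le> P$2$1"
        using nonneg_SL2_diagonal[OF nonneg_SL2_mat_prod[OF B(1)]]
          mat_prod_off_diagonal_pos[OF B(1)] B(2,3) unfolding P_def by (simp_all add: int_one_le_iff_zero_less)
      have QP: "mat_prod (Ps @ W (Suc k)) = Q ** P"
        by (simp add: W_Suc Q_def P_def mat_prod_append flip: append_assoc)
      have Q: "int k \<le> Q$2$1" "1 \<le> Q$2$2" "int k \<le> Q$2$2" using Suc by (simp_all add: Q_def)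
      have "Q$2$1 * 1 + Q$2$2 * 1 \<le> Q$2$1 * P$1$j + Q$2$2 * P$2$j" for j
        using Q P exhaust_2[of j] by (intro add_mono mult_left_mono) auto
      then show ?case using Q by (force simp: QP matrix_mult_2_entries intro: order_trans[rotated])
    qed
    have "Ps @- block_product B = (Ps @ W (nat N)) @- flat (smap B (fromN (Suc (nat N))))"
      using split[of "nat N"] by simp
    moreover have "foldr mob (Ps @ W (nat N)) (\<zeta> (nat N)) = z" using act start by simp
    moreover have "N \<le> mat_prod (Ps @ W (nat N))$2$1" "N \<le> mat_prod (Ps @ W (nat N))$2$2"
      using grow[of "nat N"] by linarith+
    ultimately show ?thesis using pos by blast
  qed
  ultimately show ?thesis unfolding converges_to_def by blast
qed

section \<open>Tails of simple continued fractions\<close>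

lemma cf_convergent_bounds:
  assumes "\<forall>k. 0 < a k"
  shows "real (a 0) \<le> cf_convergent a n \<and> cf_convergent a n \<le> real (a 0) + 1"
  using assms
proof (induction n arbitrary: a)
  case (Suc n)
  have "1 \<le> real (a 1)" using Suc.prems by (simp add: Suc_leI)
  moreover have "real (a 1) \<le> cf_convergent (\<lambda>k. a (Suc k)) n" using Suc.IH[of "\<lambda>k. a (Suc k)"] Suc.prems by simp
  ultimately have "1 \<le> cf_convergent (\<lambda>k. a (Suc k)) n" by linarith
  then show ?case by simp
qed simp

text \<open>
  One step \<open>x \<mapsto> a\<^sub>0 + 1 / x\<close> need not be contracting on \<open>x \<ge> 1\<close>, but two consecutive steps are: the composition
  \<open>x \<mapsto> a\<^sub>0 + x / (a\<^sub>1 * x + 1)\<close> divides distances by the product of two denominators, each at least 2.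
\<close>

lemma cf_convergent_contraction:
  assumes "\<forall>k. 0 < a k" "2 * j \<le> m" "2 * j \<le> n"
  shows "\<bar>cf_convergent a m - cf_convergent a n\<bar> \<le> (1/4) ^ j"
  using assms
proof (induction j arbitrary: a m n)
  case 0
  then show ?case using cf_convergent_bounds[of a m] cf_convergent_bounds[of a n] by (simp add: abs_le_iff)
next
  case (Suc j)
  obtain m' n' where mn: "m = Suc (Suc m')" "n = Suc (Suc n')"
    using that[of "m - 2" "n - 2"] Suc.prems by simp
  define b where "b k = a (Suc (Suc k))" for k
  define x y c where "x = cf_convergent b m'" and "y = cf_convergent b n'" and "c = real (a 1)"
  have b: "\<forall>k. 0 < b k" using Suc.prems by (simp add: b_def)
  have c: "1 \<le> c" using Suc.prems by (simp add: c_def Suc_leI)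
  have "1 \<le> real (b 0)" using b by (simp add: Suc_leI)
  then have xy: "1 \<le> x" "1 \<le> y"
    using cf_convergent_bounds[OF b, of m'] cf_convergent_bounds[OF b, of n'] unfolding x_def y_def by linarith+
  have IH: "\<bar>x - y\<bar> \<le> (1/4) ^ j"
    unfolding x_def y_def using Suc.prems by (intro Suc.IH b) (simp_all add: mn)
  have cx: "2 \<le> c * x + 1" "2 \<le> c * y + 1"
    using mult_mono[of 1 c 1 x] mult_mono[of 1 c 1 y] c xy by simp_all
  have "cf_convergent a m - cf_convergent a n = 1 / (c + 1 / x) - 1 / (c + 1 / y)"
    by (simp add: mn x_def y_def c_def b_def[abs_def])
  also have "\<dots> = x / (c * x + 1) - y / (c * y + 1)" using xy c by (simp add: field_simps)
  also have "\<dots> = (x - y) / ((c * x + 1) * (c * y + 1))"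
    using cx by (subst diff_frac_eq) (auto simp: algebra_simps)
  finally have "\<bar>cf_convergent a m - cf_convergent a n\<bar> = \<bar>x - y\<bar> / ((c * x + 1) * (c * y + 1))"
    using cx by (simp add: abs_mult)
  also have "\<dots> \<le> (1/4) ^ j / 4"
    using IH cx mult_mono[of 2 "c * x + 1" 2 "c * y + 1"] by (intro frac_le) auto
  finally show ?case by simp
qed

lemma cf_convergent_tendsto:
  assumes "\<forall>k. 0 < a k"
  shows "cf_convergent a \<longlonglongrightarrow> cf a"
proof -
  have "Cauchy (cf_convergent a)"
  proof (rule metric_CauchyI)
    fix e :: real assume "0 < e"
    then obtain j where "(1/4::real) ^ j < e" using real_arch_pow_inv[of e "1/4"] by auto
    then have "\<forall>m\<ge>2*j. \<forall>n\<ge>2*j. dist (cf_convergent a m) (cf_convergent a n) < e"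
      using cf_convergent_contraction[OF assms, of j] le_less_trans unfolding dist_real_def by blast
    then show "\<exists>M. \<forall>m\<ge>M. \<forall>n\<ge>M. dist (cf_convergent a m) (cf_convergent a n) < e" by blast
  qed
  then show ?thesis by (simp add: cf_def Cauchy_convergent convergent_LIMSEQ_iff[symmetric])
qed

definition cf_tail :: "(nat \<Rightarrow> nat) \<Rightarrow> nat \<Rightarrow> real" where
  "cf_tail a k = cf (\<lambda>i. a (k + i))"

lemma cf_tail_0: "cf_tail a 0 = cf a"
  by (simp add: cf_tail_def)

lemma cf_tail:
  assumes "\<forall>k. 0 < a k"
  shows cf_tail_gt_1: "1 < cf_tail a k"
    and cf_tail_rec: "cf_tail a k = real (a k) + 1 / cf_tail a (Suc k)"
proof -
  have lim: "cf_convergent (\<lambda>i. a (k + i)) \<longlonglongrightarrow> cf_tail a k" for k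
    unfolding cf_tail_def using assms by (intro cf_convergent_tendsto) simp
  have ge: "1 \<le> cf_tail a k" for k
  proof (rule LIMSEQ_le_const[OF lim])
    have "1 \<le> real (a k)" using assms by (simp add: Suc_leI)
    then show "\<exists>N. \<forall>n\<ge>N. 1 \<le> cf_convergent (\<lambda>i. a (k + i)) n"
      using cf_convergent_bounds[of "\<lambda>i. a (k + i)"] assms by (metis add.right_neutral order_trans)
  qed
  have "(\<lambda>n. real (a k) + 1 / cf_convergent (\<lambda>i. a (Suc k + i)) n) \<longlonglongrightarrow> real (a k) + 1 / cf_tail a (Suc k)"
    using ge[of "Suc k"] by (intro tendsto_intros lim) simp
  moreover have "(\<lambda>n. cf_convergent (\<lambda>i. a (k + i)) (Suc n)) \<longlonglongrightarrow> cf_tail a k"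
    by (rule LIMSEQ_Suc[OF lim])
  ultimately show rec: "cf_tail a k = real (a k) + 1 / cf_tail a (Suc k)"
    using LIMSEQ_unique by auto
  have "1 \<le> real (a k)" using assms by (simp add: Suc_leI)
  then show "1 < cf_tail a k" using rec ge[of "Suc k"] by (smt (verit) zero_less_divide_1_iff)
qed

section \<open>The transducer\<close>

definition val_M :: "real \<Rightarrow> real" where "val_M x = (x + 1) / (x - 1)"
definition val_D :: "real \<Rightarrow> real" where "val_D x = 2 * x"
definition val_E :: "real \<Rightarrow> real" where "val_E x = x / 2"

lemma val_pos:
  assumes "\<forall>k. 0 < a k"
  shows "0 < val_M (cf_tail a k)" "0 < val_D (cf_tail a k)" "0 < val_E (cf_tail a k)"
  using cf_tail_gt_1[OF assms, of k] by (simp_all add: val_M_def val_D_def val_E_def)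

lemma mob_pos:
  assumes "nonneg_SL2 X" "0 < x"
  shows "0 < mob X x"
proof -
  have "0 < real_of_int (X$1$1) * x"
    using nonneg_SL2_diagonal(1)[OF assms(1)] assms(2) by simp
  moreover have "0 \<le> real_of_int (X$1$2)" using assms(1) by (simp add: nonneg_SL2_nonneg)
  ultimately show ?thesis
    unfolding mob_def using mob_denominator_pos[OF assms] by simp
qed

text \<open>
  Inversion is the action of \<open>J\<close>, and conjugation by \<open>J\<close> exchanges \<open>R\<close> and \<open>L\<close>. Hence a rule for a
  state gives a rule for the inverted state.
\<close>

lemma mob_inverse:
  assumes "0 < u"
  shows "mob mat_R (inverse u) = inverse (mob mat_L u)"
    "mob (mat_R ^\<^sub>m n) (inverse u) = inverse (mob (mat_L ^\<^sub>m n) u)"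
    "mob mat_L (inverse u) = inverse (mob mat_R u)"
    "mob (mat_L ^\<^sub>m n) (inverse u) = inverse (mob (mat_R ^\<^sub>m n) u)"
  using assms by (simp_all add: mob_letters field_simps)

text \<open>
  Reading one partial quotient. With \<open>y = \<alpha>\<^sub>k\<^sub>+\<^sub>1\<close> and \<open>\<alpha>\<^sub>k = a\<^sub>k + 1 / y\<close>, an integer summand
  of the state's value is split off as a power of \<open>R\<close>; an integer summand of the reciprocal of the
  rest is split off as a power of \<open>L\<close>, and so on until the rest depends on \<open>y\<close> only. For instance
  \<open>val_E \<alpha>\<^sub>k = (a\<^sub>k - 1) / 2 + (y + 1) / (2 * y)\<close> for odd \<open>a\<^sub>k\<close>, and the fraction is \<open>L\<close> applied to
  \<open>(y + 1) / (y - 1)\<close>. The index \<open>k'\<close> is a variable of its own, and \<open>1\<close> is written as \<open>Suc 0\<close>, so that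
  the equations rewrite whatever normal form the simplifier gives to the indices in a block.
\<close>

lemma
  assumes a: "\<forall>k. 0 < a k" and k': "k' = Suc k"
  shows read_M_even:
    "even (a k) \<Longrightarrow> mob mat_R (mob (mat_L ^\<^sub>m ((a k - 2) div 2)) (mob mat_R (inverse (val_M (cf_tail a k')))))
      = val_M (cf_tail a k)"
  and read_M_odd:
    "odd (a k) \<Longrightarrow> mob mat_R (mob (mat_L ^\<^sub>m ((a k - Suc 0) div 2)) (val_D (cf_tail a k')))
      = val_M (cf_tail a k)"
  and read_D:
    "mob (mat_R ^\<^sub>m (2 * a k)) (inverse (val_E (cf_tail a k'))) = val_D (cf_tail a k)"
  and read_E_even:
    "even (a k) \<Longrightarrow> mob (mat_R ^\<^sub>m (a k div 2)) (inverse (val_D (cf_tail a k'))) = val_E (cf_tail a k)"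
  and read_E_odd:
    "odd (a k) \<Longrightarrow> mob (mat_R ^\<^sub>m ((a k - Suc 0) div 2)) (mob mat_L (val_M (cf_tail a k')))
      = val_E (cf_tail a k)"
proof -
  define y where "y = cf_tail a k'"
  have y: "1 < y" "cf_tail a k = real (a k) + 1 / y"
    using cf_tail_gt_1[OF a] cf_tail_rec[OF a] unfolding y_def k' by blast+
  note defs = y_def[symmetric] y(2) val_M_def val_D_def val_E_def mob_letters
  show "mob (mat_R ^\<^sub>m (2 * a k)) (inverse (val_E (cf_tail a k'))) = val_D (cf_tail a k)"
    using y(1) by (simp add: defs)
  have val_M_quotient: "val_M ((q + y) / y) = 2 * y / q + 1" if "0 < q" for q
    using y(1) that by (simp add: val_M_def field_simps)
  {
    assume "even (a k)"
    then obtain m where m: "a k = 2 * m" by (rule evenE)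
    moreover have "0 < a k" using a by blast
    ultimately obtain n where n: "a k = 2 * n + 2" using that[of "m - 1"] by simp
    have p: "0 \<le> real n * y" using y(1) by simp
    have "mob mat_R (inverse (val_M y)) = 2 * y / (y + 1)"
      using y(1) by (simp add: defs field_simps)
    moreover have "mob (mat_L ^\<^sub>m n) (2 * y / (y + 1)) = 2 * y / (2 * (real n * y) + y + 1)"
    proof -
      have "real n * (2 * y / (y + 1)) + 1 = (2 * (real n * y) + y + 1) / (y + 1)"
        using y(1) by (simp add: field_simps)
      then show ?thesis using y(1) by (simp only: mob_letters) simp
    qed
    moreover have "mob mat_R (2 * y / (2 * (real n * y) + y + 1)) = val_M (real (a k) + 1 / y)"
    proof -
      define q where "q = 2 * (real n * y) + y + 1"
      have q: "0 < q" unfolding q_def using y(1) p by linarith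
      have "real (a k) + 1 / y = (q + y) / y"
        using y(1) by (simp add: n q_def field_simps)
      then show ?thesis using val_M_quotient[OF q] by (simp add: mob_letters q_def)
    qed
    ultimately show "mob mat_R (mob (mat_L ^\<^sub>m ((a k - 2) div 2)) (mob mat_R (inverse (val_M (cf_tail a k')))))
        = val_M (cf_tail a k)"
      by (simp add: y_def[symmetric] y(2) n)
    show "mob (mat_R ^\<^sub>m (a k div 2)) (inverse (val_D (cf_tail a k'))) = val_E (cf_tail a k)"
      using y(1) by (simp add: defs n field_simps)
  next
    assume "odd (a k)"
    then obtain n where n: "a k = 2 * n + 1" by (rule oddE)
    have p: "0 \<le> real n * y" using y(1) by simp
    show "mob mat_R (mob (mat_L ^\<^sub>m ((a k - Suc 0) div 2)) (val_D (cf_tail a k'))) = val_M (cf_tail a k)"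
    proof -
      define q where "q = 2 * (real n * y) + 1"
      have q: "0 < q" unfolding q_def using p by linarith
      have "real (a k) + 1 / y = (q + y) / y"
        using y(1) by (simp add: n q_def field_simps)
      then show ?thesis
        using val_M_quotient[OF q]
        by (simp add: n q_def y_def[symmetric] y(2) val_D_def mob_letters mult.left_commute)
    qed
    have "mob mat_L (val_M y) = (y + 1) / (2 * y)"
      using y(1) by (simp add: defs field_simps)
    then show "mob (mat_R ^\<^sub>m ((a k - Suc 0) div 2)) (mob mat_L (val_M (cf_tail a k'))) = val_E (cf_tail a k)"
      using y(1) by (simp add: defs n field_simps)
  }
qed

lemma
  assumes a: "\<forall>k. 0 < a k" and k': "k' = Suc k"
  shows read_inverse_M_even:
    "even (a k) \<Longrightarrow> mob mat_L (mob (mat_R ^\<^sub>m ((a k - 2) div 2)) (mob mat_L (val_M (cf_tail a k'))))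
      = inverse (val_M (cf_tail a k))"
  and read_inverse_M_odd:
    "odd (a k) \<Longrightarrow> mob mat_L (mob (mat_R ^\<^sub>m ((a k - Suc 0) div 2)) (inverse (val_D (cf_tail a k'))))
      = inverse (val_M (cf_tail a k))"
  and read_inverse_D:
    "mob (mat_L ^\<^sub>m (2 * a k)) (val_E (cf_tail a k')) = inverse (val_D (cf_tail a k))"
  and read_inverse_E_even:
    "even (a k) \<Longrightarrow> mob (mat_L ^\<^sub>m (a k div 2)) (val_D (cf_tail a k')) = inverse (val_E (cf_tail a k))"
  and read_inverse_E_odd:
    "odd (a k) \<Longrightarrow> mob (mat_L ^\<^sub>m ((a k - Suc 0) div 2)) (mob mat_R (inverse (val_M (cf_tail a k'))))
      = inverse (val_E (cf_tail a k))"
  by (simp_all add: mob_inverse mob_pos val_pos[OF a]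
      flip: read_M_even[OF a k'] read_M_odd[OF a k'] read_D[OF a k'] read_E_even[OF a k'] read_E_odd[OF a k'])

text \<open>
  In the products starting with \<open>R\<close> to the power \<open>2 * a\<^sub>0 + 1\<close>, the factor \<open>R\<close> from the form
  \<open>TMRJ\<close> of \<open>S\<close> is merged with the first power of \<open>R\<close> read in the state \<open>val_D\<close>.
\<close>

lemma read_D_start:
  assumes "\<forall>k. 0 < a k" "k' = Suc k"
  shows "mob (mat_R ^\<^sub>m Suc (2 * a k)) (inverse (val_E (cf_tail a k'))) = mob mat_R (val_D (cf_tail a k))"
  using read_D(1)[OF assms] by (simp add: mob_letters)

lemma equiv_product_blocks:
  fixes \<zeta> :: "nat \<Rightarrow> real"
  assumes T: "unimodular T" and w: "w = mob T z"
    and *: "\<And>k. 0 < \<zeta> k" "\<forall>X\<in>set Ps. nonneg_SL2 X" "foldr mob Ps (\<zeta> 0) = z"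
      "\<And>k. foldr mob (B (Suc k)) (\<zeta> (Suc k)) = \<zeta> k"
      "\<And>k. \<forall>X\<in>set (B (Suc k)). nonneg_SL2 X"
      "\<And>k. \<exists>X\<in>set (B (Suc k)). 0 < X$1$2" "\<And>k. \<exists>X\<in>set (B (Suc k)). 0 < X$2$1"
  shows "equiv_product w ((T # Ps) @- block_product B)"
  using equiv_product_mob[OF T converges_to_block_product[OF *(2,5,6,7,1,4,3)]] w by simp

section \<open>The twelve products\<close>

theorem theorem2p3:
  fixes A B C D :: int and \<sigma> :: "real \<Rightarrow> real" and S T :: "int^2^2"
  assumes "\<bar>A * D - B * C\<bar> = 2"
    and "\<forall>x. \<sigma> x = (of_int A * x + of_int B) / (of_int C * x + of_int D)"
    and "S = vector [vector [A, B], vector [C, D]]"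
    and "unimodular T"
    and "S = T ** mat_M \<or> S = T ** mat_M ** mat_R \<or> S = T ** mat_M ** mat_R ** mat_J"
  shows "
    (\<forall>a. CF1 a \<longrightarrow>
         equiv_product (\<sigma> (cf a))
           ([T] @-
            block_product (\<lambda>k.
              [mat_R, mat_L ^\<^sub>m ((a (2*k - 2) - 2) div 2), mat_R, mat_L,
                mat_R ^\<^sub>m ((a (2*k - 1) - 2) div 2), mat_L])) \<or>
         equiv_product (\<sigma> (cf a))
           ([T, mat_R] @-
            block_product (\<lambda>k.
              [mat_L ^\<^sub>m (a (2*k - 2) div 2), mat_R ^\<^sub>m (2 * a (2*k - 1))])) \<or>
         equiv_product (\<sigma> (cf a))
           ([T, mat_R ^\<^sub>m (2 * a 0 + 1)] @-
            block_product (\<lambda>k.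
              [mat_L ^\<^sub>m (a (2*k - 1) div 2), mat_R ^\<^sub>m (2 * a (2*k))]))) \<and>
    (\<forall>a. CF2 a \<longrightarrow>
         equiv_product (\<sigma> (cf a))
           ([T] @-
            block_product (\<lambda>k.
              [mat_R, mat_L ^\<^sub>m ((a (6*k - 6) - 1) div 2), mat_R ^\<^sub>m (2 * a (6*k - 5)), mat_L ^\<^sub>m ((a (6*k - 4) - 1) div 2),
                mat_R, mat_L, mat_R ^\<^sub>m ((a (6*k - 3) - 1) div 2), mat_L ^\<^sub>m (2 * a (6*k - 2)),
                mat_R ^\<^sub>m ((a (6*k - 1) - 1) div 2), mat_L])) \<or>
         equiv_product (\<sigma> (cf a))
           ([T, mat_R, mat_L ^\<^sub>m ((a 0 - 1) div 2), mat_R] @-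
            block_product (\<lambda>k.
              [mat_L, mat_R ^\<^sub>m ((a (6*k - 5) - 1) div 2), mat_L ^\<^sub>m (2 * a (6*k - 4)), mat_R ^\<^sub>m ((a (6*k - 3) - 1) div 2),
                mat_L, mat_R, mat_L ^\<^sub>m ((a (6*k - 2) - 1) div 2), mat_R ^\<^sub>m (2 * a (6*k - 1)),
                mat_L ^\<^sub>m ((a (6*k) - 1) div 2), mat_R])) \<or>
         equiv_product (\<sigma> (cf a))
           ([T, mat_R ^\<^sub>m (2 * a 0 + 1), mat_L ^\<^sub>m ((a 1 - 1) div 2), mat_R] @-
            block_product (\<lambda>k.
              [mat_L, mat_R ^\<^sub>m ((a (6*k - 4) - 1) div 2), mat_L ^\<^sub>m (2 * a (6*k - 3)), mat_R ^\<^sub>m ((a (6*k - 2) - 1) div 2),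
                mat_L, mat_R, mat_L ^\<^sub>m ((a (6*k - 1) - 1) div 2), mat_R ^\<^sub>m (2 * a (6*k)),
                mat_L ^\<^sub>m ((a (6*k + 1) - 1) div 2), mat_R]))) \<and>
    (\<forall>a. CF3 a \<longrightarrow>
         equiv_product (\<sigma> (cf a))
           ([T] @-
            block_product (\<lambda>k.
              [mat_R, mat_L ^\<^sub>m ((a (4*k - 4) - 1) div 2), mat_R ^\<^sub>m (2 * a (4*k - 3)), mat_L ^\<^sub>m ((a (4*k - 2) - 1) div 2),
                mat_R, mat_L, mat_R ^\<^sub>m ((a (4*k - 1) - 2) div 2), mat_L])) \<or>
         equiv_product (\<sigma> (cf a))
           ([T, mat_R, mat_L ^\<^sub>m ((a 0 - 1) div 2), mat_R, mat_L, mat_R ^\<^sub>m ((a 1 - 2) div 2), mat_L] @-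
            block_product (\<lambda>k.
              [mat_R, mat_L ^\<^sub>m ((a (4*k - 2) - 1) div 2), mat_R ^\<^sub>m (2 * a (4*k - 1)), mat_L ^\<^sub>m ((a (4*k) - 1) div 2),
                mat_R, mat_L, mat_R ^\<^sub>m ((a (4*k + 1) - 2) div 2), mat_L])) \<or>
         equiv_product (\<sigma> (cf a))
           ([T, mat_R ^\<^sub>m (2 * a 0 + 1)] @-
            block_product (\<lambda>k.
              [mat_L ^\<^sub>m (a (2*k - 1) div 2), mat_R ^\<^sub>m (2 * a (2*k))]))) \<and>
    (\<forall>a. CF4 a \<longrightarrow>
         equiv_product (\<sigma> (cf a))
           ([T, mat_R, mat_L ^\<^sub>m ((a 0 - 2) div 2), mat_R] @-
            block_product (\<lambda>k.
              [mat_L, mat_R ^\<^sub>m ((a (4*k - 3) - 1) div 2), mat_L ^\<^sub>m (2 * a (4*k - 2)), mat_R ^\<^sub>m ((a (4*k - 1) - 1) div 2),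
                mat_L, mat_R, mat_L ^\<^sub>m ((a (4*k) - 2) div 2), mat_R])) \<or>
         equiv_product (\<sigma> (cf a))
           ([T, mat_R] @-
            block_product (\<lambda>k.
              [mat_L ^\<^sub>m (a (2*k - 2) div 2), mat_R ^\<^sub>m (2 * a (2*k - 1))])) \<or>
         equiv_product (\<sigma> (cf a))
           ([T, mat_R ^\<^sub>m (2 * a 0 + 1), mat_L ^\<^sub>m ((a 1 - 1) div 2), mat_R, mat_L, mat_R ^\<^sub>m ((a 2 - 2) div 2), mat_L] @-
            block_product (\<lambda>k.
              [mat_R, mat_L ^\<^sub>m ((a (4*k - 1) - 1) div 2), mat_R ^\<^sub>m (2 * a (4*k)), mat_L ^\<^sub>m ((a (4*k + 1) - 1) div 2),
                mat_R, mat_L, mat_R ^\<^sub>m ((a (4*k + 2) - 2) div 2), mat_L])))"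
    (is "(\<forall>a. CF1 a \<longrightarrow> ?P1 a) \<and> (\<forall>a. CF2 a \<longrightarrow> ?P2 a) \<and> (\<forall>a. CF3 a \<longrightarrow> ?P3 a) \<and> (\<forall>a. CF4 a \<longrightarrow> ?P4 a)")
proof -
  have start: "\<sigma> (cf a) = mob T (val_M (cf_tail a 0)) \<or>
      \<sigma> (cf a) = mob T (mob mat_R (inverse (val_E (cf_tail a 0)))) \<or>
      \<sigma> (cf a) = mob T (mob mat_R (val_D (cf_tail a 0)))" if "\<forall>k. 0 < a k" for a
  proof -
    define x where "x = cf_tail a 0"
    have x: "1 < x" using cf_tail_gt_1[OF that] by (simp add: x_def)
    have \<sigma>: "\<sigma> (cf a) = mob S x" using assms(2,3) by (simp add: mob_def x_def cf_tail_0)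
    have "S = T ** mat_M \<or> S = T ** (mat_M ** mat_R) \<or> S = T ** (mat_M ** mat_R ** mat_J)"
      using assms(5) by (simp add: matrix_mul_assoc)
    moreover have "mob (T ** mat_M) x = mob T (mob mat_M x)"
      "mob (T ** (mat_M ** mat_R)) x = mob T (mob (mat_M ** mat_R) x)"
      "mob (T ** (mat_M ** mat_R ** mat_J)) x = mob T (mob (mat_M ** mat_R ** mat_J) x)"
      using x by (simp_all add: mob_mult matrix_mult_2_entries mat_M_def mat_J_def)
    moreover have "mob mat_M x = val_M x"
      "mob (mat_M ** mat_R) x = mob mat_R (inverse (val_E x))"
      "mob (mat_M ** mat_R ** mat_J) x = mob mat_R (val_D x)"
      using x by (simp_all add: mob_def matrix_mult_2_entries mat_M_def mat_J_def val_M_def val_D_def val_E_def field_simps)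
    ultimately show ?thesis unfolding \<sigma> x_def by metis
  qed
  (* In each case below, \<zeta> k is the value of the state of the transducer at the start of the block after the
     first k blocks. The factors before the blocks, if any, take the run from its initial state
     to the state that recurs; then the rules in read carry it once around the period. *)
  note read = read_M_even read_M_odd read_D read_E_even read_E_odd read_D_start
    read_inverse_M_even read_inverse_M_odd read_inverse_D read_inverse_E_even read_inverse_E_odd
  have "?P1 a" if CF: "CF1 a" for a
  proof -
    have pos: "\<forall>k. 0 < a k" and par: "\<And>k. even (a k)" using CF by (auto simp: CF1_def)
    have ge2: "0 < a k div 2" for k using pos par by (metis dvd_div_eq_0_iff not_gr0)
    from start[OF pos] show ?thesis
    proof (elim disjE, goal_cases)
      case 1
      show ?case
        by (rule disjI1, rule equiv_product_blocks[where \<zeta> = "\<lambda>k. val_M (cf_tail a (2*k))", OF assms(4) 1])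
          (use pos par ge2 in \<open>simp_all add: val_pos read\<close>)
    next
      case 2
      show ?case
        by (rule disjI2, rule disjI1, rule equiv_product_blocks[where \<zeta> = "\<lambda>k. inverse (val_E (cf_tail a (2*k)))", OF assms(4) 2])
          (use pos par ge2 in \<open>simp_all add: val_pos read\<close>)
    next
      case 3
      show ?case
        by (rule disjI2, rule disjI2, rule equiv_product_blocks[where \<zeta> = "\<lambda>k. inverse (val_E (cf_tail a (2*k+1)))", OF assms(4) 3])
          (use pos par ge2 in \<open>simp_all add: val_pos read\<close>)
    qed
  qed
  moreover have "?P2 a" if CF: "CF2 a" for a
  proof -
    have pos: "\<forall>k. 0 < a k" and par: "\<And>k. odd (a k)" using CF by (auto simp: CF2_def)
    from start[OF pos] show ?thesis
    proof (elim disjE, goal_cases)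
      case 1
      show ?case
        by (rule disjI1, rule equiv_product_blocks[where \<zeta> = "\<lambda>k. val_M (cf_tail a (6*k))", OF assms(4) 1])
          (use pos par in \<open>simp_all add: val_pos read\<close>)
    next
      case 2
      show ?case
        by (rule disjI2, rule disjI1, rule equiv_product_blocks[where \<zeta> = "\<lambda>k. inverse (val_M (cf_tail a (6*k+1)))", OF assms(4) 2])
          (use pos par in \<open>simp_all add: val_pos read\<close>)
    next
      case 3
      show ?case
        by (rule disjI2, rule disjI2, rule equiv_product_blocks[where \<zeta> = "\<lambda>k. inverse (val_M (cf_tail a (6*k+2)))", OF assms(4) 3])
          (use pos par in \<open>simp_all add: val_pos read\<close>)
    qed
  qed
  moreover have "?P3 a" if CF: "CF3 a" for a
  proof -
    have pos: "\<forall>k. 0 < a k" and par: "\<And>k. even (a k) = odd k" using CF by (auto simp: CF3_def)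
    have ge2: "0 < a k div 2" if "odd k" for k using pos par that by (metis dvd_div_eq_0_iff not_gr0)
    from start[OF pos] show ?thesis
    proof (elim disjE, goal_cases)
      case 1
      show ?case
        by (rule disjI1, rule equiv_product_blocks[where \<zeta> = "\<lambda>k. val_M (cf_tail a (4*k))", OF assms(4) 1])
          (use pos par ge2 in \<open>simp_all add: val_pos read\<close>)
    next
      case 2
      show ?case
        by (rule disjI2, rule disjI1, rule equiv_product_blocks[where \<zeta> = "\<lambda>k. val_M (cf_tail a (4*k+2))", OF assms(4) 2])
          (use pos par ge2 in \<open>simp_all add: val_pos read\<close>)
    next
      case 3
      show ?case
        by (rule disjI2, rule disjI2, rule equiv_product_blocks[where \<zeta> = "\<lambda>k. inverse (val_E (cf_tail a (2*k+1)))", OF assms(4) 3])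
          (use pos par ge2 in \<open>simp_all add: val_pos read\<close>)
    qed
  qed
  moreover have "?P4 a" if CF: "CF4 a" for a
  proof -
    have pos: "\<forall>k. 0 < a k" and par: "\<And>k. even (a k) = even k" using CF by (auto simp: CF4_def)
    have ge2: "0 < a k div 2" if "even k" for k using pos par that by (metis dvd_div_eq_0_iff not_gr0)
    from start[OF pos] show ?thesis
    proof (elim disjE, goal_cases)
      case 1
      show ?case
        by (rule disjI1, rule equiv_product_blocks[where \<zeta> = "\<lambda>k. inverse (val_M (cf_tail a (4*k+1)))", OF assms(4) 1])
          (use pos par ge2 in \<open>simp_all add: val_pos read\<close>)
    next
      case 2
      show ?case
        by (rule disjI2, rule disjI1, rule equiv_product_blocks[where \<zeta> = "\<lambda>k. inverse (val_E (cf_tail a (2*k)))", OF assms(4) 2])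
          (use pos par ge2 in \<open>simp_all add: val_pos read\<close>)
    next
      case 3
      show ?case
        by (rule disjI2, rule disjI2, rule equiv_product_blocks[where \<zeta> = "\<lambda>k. val_M (cf_tail a (3 + 4*k))", OF assms(4) 3])
          (use pos par ge2 in \<open>simp_all add: val_pos read\<close>)
    qed
  qed
  ultimately show ?thesis by blast
qed

end
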